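(* Let $m,n\ge1$. The map $\phi:\mathsf{EW}_{m,n}\to\mathsf{LRib}_{m,n}$ described in the context is injective.
   Context: All tableaux are $0/1$ arrays; $T_{ij}$ denotes the entry in row $i$ (rows numbered top to bottom) and column $j$ (columns numbered left to right). Labels are symbols $v_0,v_1,\dots,v_{m+n-1}$, ordered by $v_i<v_j$ iff $i<j$. Rectangular EW-tableau: an $m\times n$ $0/1$ tableau $T$ such that (i) every entry of the top row is $1$; (ii) every other row contains at least one $0$; (iii) there are no rows $i\ne i'$ and columns $k\ne k'$ with $T_{ik}=T_{i'k'}=0$ and $T_{ik'}=T_{i'k}=1$. $\mathsf{EW}_{m,n}$ is the set of these. The rows of $T$ are labelled $v_0,\dots,v_{m-1}$ from top to bottom and the columns $v_m,\dots,v_{m+n-1}$ from left to right. Parallelogram polyomino of type $(m,n)$: an $m\times n$ $0/1$ tableau $P$ with $P_{11}=P_{mn}=1$, such that every row contains at least one $1$ and the $1$s in each row are contiguous, and for each $2\le i\le m$: the leftmost $1$ of row $i$ is weakly to the right of the leftmost $1$ of row $i-1$ and weakly to the left of the rightmost $1$ of row $i-1$, and the rightmost $1$ of row $i$ is weakly to the right of the rightmost $1$ of row $i-1$. It is a ribbon parallelogram polyomino if it has exactly $m+n-1$ entries equal to $1$. Labelled parallelogram polyomino of type $(m,n)$: a pair $(P,\ell)$ with $P$ a parallelogram polyomino of type $(m,n)$ and $\ell=(\ell(\mathrm{row}_1),\dots,\ell(\mathrm{row}_m),\ell(\mathrm{col}_1),\dots,\ell(\mathrm{col}_n))$, where the row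 labels are a permutation of $\{v_0,\dots,v_{m-1}\}$ with $\ell(\mathrm{row}_1)=v_0$ and such that the labels of rows whose leftmost $1$s lie in the same column are increasing from top to bottom, and the column labels are a permutation of $\{v_m,\dots,v_{m+n-1}\}$ such that the labels of columns whose topmost $1$s lie in the same row are increasing from left to right. $\mathsf{LRib}_{m,n}$ is the set of those with $P$ a ribbon parallelogram polyomino. The map $\phi$: given $T\in\mathsf{EW}_{m,n}$ with its labels, (1) permute the columns (carrying their labels) so that every entry to the left of a $0$ is a $0$, with identical columns placed so their labels increase from left to right; (2) then permute the rows (carrying labels) so that every entry above a $1$ is a $1$, with identical rows placed so their labels increase from top to bottom; call the result $T'$ and the resulting labelling $\ell$. (3) Let $R$ be the $m\times n$ tableau with $R_{ij}=1$ if either [$T'_{ij}=1$ and ($i=m$ or $T'_{i+1,j}=0$)] or [$T'_{ij}=0$ and ($j=n$ or $T'_{i,j+1}=1$)], and $R_{ij}=0$ otherwise. Set $\phi(T)=(R,\ell)$; this lies in $\mathsf{LRib}_{m,n}$. *)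

theory Defs
  imports
    "Jordan_Normal_Form.Matrix"
    "HOL-Combinatorics.Combinatorics"
begin

text \<open>
  Rows and columns are indexed from 0, so the entry in row i and column j of the usual
  1-based convention is the entry at (i - 1, j - 1) of the matrix.
  The label v_k is represented by the natural number k.
\<close>

definition tableau :: "nat \<Rightarrow> nat \<Rightarrow> nat mat \<Rightarrow> bool" where
  "tableau m n T \<longleftrightarrow> T \<in> carrier_mat m n \<and> (\<forall>i<m. \<forall>j<n. T $$ (i, j) \<in> {0, 1})"

definition EW :: "nat \<Rightarrow> nat \<Rightarrow> nat mat set" where
  "EW m n = {T. tableau m n T
     \<and> (\<forall>j<n. T $$ (0, j) = 1)
     \<and> (\<forall>i<m. i \<noteq> 0 \<longrightarrow> (\<exists>j<n. T $$ (i, j) = 0))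
     \<and> \<not> (\<exists>i i' k k'. i < m \<and> i' < m \<and> k < n \<and> k' < n \<and> i \<noteq> i' \<and> k \<noteq> k'
            \<and> T $$ (i, k) = 0 \<and> T $$ (i', k') = 0
            \<and> T $$ (i, k') = 1 \<and> T $$ (i', k) = 1)}"


subsection \<open>Parallelogram polyominoes\<close>

definition leftmost :: "nat mat \<Rightarrow> nat \<Rightarrow> nat" where
  "leftmost P i = Min {j. j < dim_col P \<and> P $$ (i, j) = 1}"

definition rightmost :: "nat mat \<Rightarrow> nat \<Rightarrow> nat" where
  "rightmost P i = Max {j. j < dim_col P \<and> P $$ (i, j) = 1}"

definition topmost :: "nat mat \<Rightarrow> nat \<Rightarrow> nat" where
  "topmost P j = Min {i. i < dim_row P \<and> P $$ (i, j) = 1}"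

definition parallelogram_polyomino :: "nat \<Rightarrow> nat \<Rightarrow> nat mat \<Rightarrow> bool" where
  "parallelogram_polyomino m n P \<longleftrightarrow> tableau m n P
     \<and> P $$ (0, 0) = 1 \<and> P $$ (m - 1, n - 1) = 1
     \<and> (\<forall>i<m. \<exists>j<n. P $$ (i, j) = 1)
     \<and> (\<forall>i<m. \<forall>j k l. j \<le> k \<and> k \<le> l \<and> l < n \<and> P $$ (i, j) = 1 \<and> P $$ (i, l) = 1
            \<longrightarrow> P $$ (i, k) = 1)
     \<and> (\<forall>i. 1 \<le> i \<and> i < m \<longrightarrow>
            leftmost P (i - 1) \<le> leftmost P i
          \<and> leftmost P i \<le> rightmost P (i - 1)
          \<and> rightmost P (i - 1) \<le> rightmost P i)"

definition ribbon :: "nat \<Rightarrow> nat \<Rightarrow> nat mat \<Rightarrow> bool" where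
  "ribbon m n P \<longleftrightarrow> parallelogram_polyomino m n P
     \<and> card {(i, j). i < m \<and> j < n \<and> P $$ (i, j) = 1} = m + n - 1"

text \<open>A labelling is the pair of the list of row labels (top to bottom) and the list of
  column labels (left to right).\<close>

type_synonym labelling = "nat list \<times> nat list"

definition LPP :: "nat \<Rightarrow> nat \<Rightarrow> (nat mat \<times> labelling) set" where
  "LPP m n = {(P, rs, cs). parallelogram_polyomino m n P
     \<and> rs \<in> permutations_of_set {0..<m} \<and> rs ! 0 = 0
     \<and> (\<forall>i i'. i < i' \<and> i' < m \<and> leftmost P i = leftmost P i' \<longrightarrow> rs ! i < rs ! i')
     \<and> cs \<in> permutations_of_set {m..<m + n}
     \<and> (\<forall>j j'. j < j' \<and> j' < n \<and> topmost P j = topmost P j' \<longrightarrow> cs ! j < cs ! j')}"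

definition LRib :: "nat \<Rightarrow> nat \<Rightarrow> (nat mat \<times> labelling) set" where
  "LRib m n = {(P, l) \<in> LPP m n. ribbon m n P}"


subsection \<open>The map\<close>

definition initial_labels :: "nat mat \<Rightarrow> nat mat \<times> labelling" where
  "initial_labels T = (T, [0..<dim_row T], [dim_row T..<dim_row T + dim_col T])"

fun permute_columns :: "(nat \<Rightarrow> nat) \<Rightarrow> nat mat \<times> labelling \<Rightarrow> nat mat \<times> labelling" where
  "permute_columns \<sigma> (T, rs, cs) =
     (mat (dim_row T) (dim_col T) (\<lambda>(i, j). T $$ (i, \<sigma> j)), rs, permute_list \<sigma> cs)"

fun permute_rows :: "(nat \<Rightarrow> nat) \<Rightarrow> nat mat \<times> labelling \<Rightarrow> nat mat \<times> labelling" where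
  "permute_rows \<tau> (T, rs, cs) =
     (mat (dim_row T) (dim_col T) (\<lambda>(i, j). T $$ (\<tau> i, j)), permute_list \<tau> rs, cs)"

fun columns_arranged :: "nat mat \<times> labelling \<Rightarrow> bool" where
  "columns_arranged (T, rs, cs) \<longleftrightarrow>
     (\<forall>i<dim_row T. \<forall>j<dim_col T. T $$ (i, j) = 0 \<longrightarrow> (\<forall>j'<j. T $$ (i, j') = 0))
   \<and> (\<forall>j j'. j < j' \<and> j' < dim_col T \<and> col T j = col T j' \<longrightarrow> cs ! j < cs ! j')"

fun rows_arranged :: "nat mat \<times> labelling \<Rightarrow> bool" where
  "rows_arranged (T, rs, cs) \<longleftrightarrow>
     (\<forall>i<dim_row T. \<forall>j<dim_col T. T $$ (i, j) = 1 \<longrightarrow> (\<forall>i'<i. T $$ (i', j) = 1))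
   \<and> (\<forall>i i'. i < i' \<and> i' < dim_row T \<and> row T i = row T i' \<longrightarrow> rs ! i < rs ! i')"

text \<open>
  The two arrangement steps are given by definite descriptions. For a tableau in EW the
  required arrangement exists, by the last condition in EW, and the rule for identical columns
  (respectively rows) makes it unique.
\<close>

definition arrange_columns :: "nat mat \<times> labelling \<Rightarrow> nat mat \<times> labelling" where
  "arrange_columns L = (THE L'. \<exists>\<sigma>. \<sigma> permutes {0..<dim_col (fst L)}
     \<and> L' = permute_columns \<sigma> L \<and> columns_arranged L')"

definition arrange_rows :: "nat mat \<times> labelling \<Rightarrow> nat mat \<times> labelling" where
  "arrange_rows L = (THE L'. \<exists>\<tau>. \<tau> permutes {0..<dim_row (fst L)}
     \<and> L' = permute_rows \<tau> L \<and> rows_arranged L')"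

definition ribbon_of :: "nat mat \<Rightarrow> nat mat" where
  "ribbon_of T = mat (dim_row T) (dim_col T) (\<lambda>(i, j).
     if T $$ (i, j) = 1 \<and> (i = dim_row T - 1 \<or> T $$ (i + 1, j) = 0)
      \<or> T $$ (i, j) = 0 \<and> (j = dim_col T - 1 \<or> T $$ (i, j + 1) = 1)
     then 1 else 0)"

definition phi :: "nat mat \<Rightarrow> nat mat \<times> labelling" where
  "phi T = (let (T', l) = arrange_rows (arrange_columns (initial_labels T))
            in (ribbon_of T', l))"

end

theory Submission
  imports Defs
begin

text \<open>
  After the two arrangement steps a tableau in EW is a staircase: row i consists of z i zeros
  followed by ones, where 0 = z 0 < z 1 \<le> \<dots> \<le> z (m - 1) \<le> n. With z m = n, row i of the
  resulting tableau R has its ones exactly in the columns j with z i - 1 \<le> j < z (i + 1)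
  (truncated subtraction), so consecutive rows overlap in exactly one column and R is a ribbon. The
  right ends of its rows give back z, hence the staircase, and the labels then tell how to undo
  the two permutations. The arrangement steps are well defined because the sets of ones of the
  columns (the sets of zeros of the rows) form a chain.
\<close>

section \<open>Unique sorting permutations and arrangements of chains of sets\<close>

section \<open>Sorting\<close>

text \<open>Sorting the indices by \<open>g\<close> gives existence; uniqueness holds because a
  strictly increasing list is determined by its set of elements.\<close>

lemma ex1_sorting_permutation:
  fixes g :: "nat \<Rightarrow> 'a::linorder"
  assumes inj: "inj_on g {0..<n}"
  shows "\<exists>!\<sigma>. \<sigma> permutes {0..<n} \<and> (\<forall>i j. i < j \<and> j < n \<longrightarrow> g (\<sigma> i) < g (\<sigma> j))"
proof (rule ex_ex1I)
  define xs where "xs = sort_key g [0..<n]"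
  \<comment> \<open>Outside \<open>{0..<n}\<close> this is the identity, as \<open>permutes\<close>
    requires.\<close>
  define \<sigma> where "\<sigma> i = (if i < n then xs ! i else i)" for i
  have len: "length xs = n" and set_xs: "set xs = {0..<n}" and dist: "distinct xs"
    by (simp_all add: xs_def)
  have "bij_betw ((!) xs) {..<n} {0..<n}"
    using bij_betw_nth[OF dist _ refl] len set_xs by simp
  then have "bij_betw \<sigma> {0..<n} {0..<n}"
    by (subst bij_betw_cong[of _ _ "(!) xs"]) (auto simp: \<sigma>_def lessThan_atLeast0)
  then have perm: "\<sigma> permutes {0..<n}"
    by (rule bij_imp_permutes) (auto simp: \<sigma>_def)
  have "g (\<sigma> i) < g (\<sigma> j)" if "i < j" "j < n" for i j
  proof -
    have "sorted (map g xs)"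
      by (simp add: xs_def)
    then have "map g xs ! i \<le> map g xs ! j"
      using that len by (intro sorted_nth_mono) auto
    moreover have "g (xs ! i) \<noteq> g (xs ! j)"
      using inj that dist len set_xs
      by (metis inj_onD less_trans nat_less_le nth_eq_iff_index_eq nth_mem)
    ultimately show ?thesis
      using that len by (simp add: \<sigma>_def)
  qed
  with perm show "\<exists>\<sigma>. \<sigma> permutes {0..<n} \<and> (\<forall>i j. i < j \<and> j < n \<longrightarrow> g (\<sigma> i) < g (\<sigma> j))"
    by blast
next
  fix \<sigma> \<tau>
  assume *: "\<sigma> permutes {0..<n} \<and> (\<forall>i j. i < j \<and> j < n \<longrightarrow> g (\<sigma> i) < g (\<sigma> j))"
    "\<tau> permutes {0..<n} \<and> (\<forall>i j. i < j \<and> j < n \<longrightarrow> g (\<tau> i) < g (\<tau> j))"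
  \<comment> \<open>Any solution \<open>f\<close> lists the image of \<open>{0..<n}\<close> under
    \<open>g\<close> in increasing order, so two solutions yield the same list.\<close>
  have key: "sorted_wrt (<) (map (g \<circ> f) [0..<n]) \<and> set (map (g \<circ> f) [0..<n]) = g ` {0..<n}"
    if "f permutes {0..<n} \<and> (\<forall>i j. i < j \<and> j < n \<longrightarrow> g (f i) < g (f j))" for f
  proof -
    have "(g \<circ> f) ` {0..<n} = g ` {0..<n}"
      using that by (metis image_comp permutes_image)
    with that show ?thesis
      by (simp add: sorted_wrt_iff_nth_less)
  qed
  have "map (g \<circ> \<sigma>) [0..<n] = map (g \<circ> \<tau>) [0..<n]"
    using key[OF *(1)] key[OF *(2)] strict_sorted_equal by metis
  then have "g (\<sigma> i) = g (\<tau> i)" if "i < n" for i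
    using that by simp
  moreover have "\<sigma> i \<in> {0..<n}" "\<tau> i \<in> {0..<n}" if "i < n" for i
    using that * by (simp_all only: permutes_in_image) simp_all
  ultimately have "\<sigma> i = \<tau> i" if "i < n" for i
    using that inj by (simp add: inj_on_eq_iff)
  moreover have "\<sigma> i = \<tau> i" if "\<not> i < n" for i
    using that * permutes_not_in[of \<sigma> "{0..<n}" i] permutes_not_in[of \<tau> "{0..<n}" i] by simp
  ultimately show "\<sigma> = \<tau>"
    by blast
qed

text \<open>Inclusion in a chain of finite sets is decided by cardinality, so ordering by inclusion
  with ties broken by index amounts to sorting by one injective numerical key.\<close>

lemma ex1_chain_arrangement:
  fixes A :: "nat \<Rightarrow> 'a set"
  assumes fin: "\<And>i. i < n \<Longrightarrow> finite (A i)"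
    and chain: "\<And>i j. i < n \<Longrightarrow> j < n \<Longrightarrow> A i \<subseteq> A j \<or> A j \<subseteq> A i"
  shows "\<exists>!\<sigma>. \<sigma> permutes {0..<n} \<and>
    (\<forall>i j. i < j \<and> j < n \<longrightarrow> A (\<sigma> i) \<subseteq> A (\<sigma> j) \<and> (A (\<sigma> i) = A (\<sigma> j) \<longrightarrow> \<sigma> i < \<sigma> j))"
proof -
  \<comment> \<open>Codes the lexicographic order on pairs \<open>(card (A i), i)\<close>; as
    \<open>i < n\<close>, quotient and remainder by \<open>n\<close> recover both parts.\<close>
  define g where "g i = card (A i) * n + i" for i
  have g_div_mod: "g i div n = card (A i)" "g i mod n = i" if "i < n" for i
    using that by (auto simp: g_def)
  have inj: "inj_on g {0..<n}"
    by (rule inj_onI) (metis atLeastLessThan_iff g_div_mod(2))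
  have less_iff: "g a < g b \<longleftrightarrow> A a \<subseteq> A b \<and> (A a = A b \<longrightarrow> a < b)" if "a < n" "b < n" for a b
  proof
    assume less: "g a < g b"
    then have "card (A a) \<le> card (A b)"
      using g_div_mod that by (metis div_le_mono less_imp_le)
    then have "A a \<subseteq> A b"
      using chain fin that by (metis card_seteq subset_refl)
    moreover have "a < b" if "A a = A b"
      using less that by (simp add: g_def)
    ultimately show "A a \<subseteq> A b \<and> (A a = A b \<longrightarrow> a < b)"
      by blast
  next
    assume *: "A a \<subseteq> A b \<and> (A a = A b \<longrightarrow> a < b)"
    show "g a < g b"
    proof (cases "A a = A b")
      case False
      \<comment> \<open>One more element raises the key by \<open>n\<close>, which outweighs any
        difference of indices.\<close>
      with * fin that have "Suc (card (A a)) \<le> card (A b)"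
        by (simp add: psubset_card_mono psubset_eq Suc_le_eq)
      then have "Suc (card (A a)) * n \<le> card (A b) * n"
        by (rule mult_le_mono1)
      with that show ?thesis
        by (simp add: g_def)
    qed (use * in \<open>simp add: g_def\<close>)
  qed
  have iff: "(\<sigma> permutes {0..<n} \<and> (\<forall>i j. i < j \<and> j < n \<longrightarrow> g (\<sigma> i) < g (\<sigma> j))) \<longleftrightarrow>
      (\<sigma> permutes {0..<n} \<and>
      (\<forall>i j. i < j \<and> j < n \<longrightarrow> A (\<sigma> i) \<subseteq> A (\<sigma> j) \<and> (A (\<sigma> i) = A (\<sigma> j) \<longrightarrow> \<sigma> i < \<sigma> j)))"
    for \<sigma>
  proof (rule conj_cong[OF refl])
    assume "\<sigma> permutes {0..<n}"
    then have "\<sigma> i < n" if "i < n" for i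
      using that permutes_in_image[of \<sigma> "{0..<n}" i] by simp
    then show "(\<forall>i j. i < j \<and> j < n \<longrightarrow> g (\<sigma> i) < g (\<sigma> j)) \<longleftrightarrow>
      (\<forall>i j. i < j \<and> j < n \<longrightarrow> A (\<sigma> i) \<subseteq> A (\<sigma> j) \<and> (A (\<sigma> i) = A (\<sigma> j) \<longrightarrow> \<sigma> i < \<sigma> j))"
      by (intro iff_allI imp_cong refl less_iff) auto
  qed
  show ?thesis
    using ex1_sorting_permutation[OF inj] unfolding iff .
qed

section \<open>Existence and uniqueness of the column and row arrangements\<close>

section \<open>The arrangement steps\<close>

lemma tableau_entry: "tableau m n T \<Longrightarrow> i < m \<Longrightarrow> j < n \<Longrightarrow> T $$ (i, j) = 0 \<or> T $$ (i, j) = 1"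
  by (auto simp: tableau_def)

text \<open>Zeros spreading to the left are ones spreading to the right, so the sets of ones grow.
  As 0/1 columns agree when their sets of ones do, and the label at position \<open>j\<close> is
  \<open>m + \<sigma> j\<close>, comparing labels of equal columns is comparing indices.\<close>

lemma columns_arranged_permute_iff:
  assumes T: "tableau m n T" and perm: "\<sigma> permutes {0..<n}"
  defines "A \<equiv> \<lambda>j. {i. i < m \<and> T $$ (i, j) = 1}"
  shows "columns_arranged (permute_columns \<sigma> (initial_labels T)) \<longleftrightarrow>
    (\<forall>i j. i < j \<and> j < n \<longrightarrow> A (\<sigma> i) \<subseteq> A (\<sigma> j) \<and> (A (\<sigma> i) = A (\<sigma> j) \<longrightarrow> \<sigma> i < \<sigma> j))"
proof -
  have dim: "dim_row T = m" "dim_col T = n"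
    using T by (auto simp: tableau_def)
  have \<sigma>: "\<sigma> j < n" if "j < n" for j
    using that permutes_in_image[OF perm, of j] by simp
  let ?M = "mat m n (\<lambda>(i, j). T $$ (i, \<sigma> j))"
  have entry: "T $$ (i, \<sigma> j) \<noteq> 0 \<longleftrightarrow> T $$ (i, \<sigma> j) = 1" if "i < m" "j < n" for i j
    using tableau_entry[OF T that(1) \<sigma>[OF that(2)]] by auto
  have cols: "col ?M j = col ?M j' \<longleftrightarrow> A (\<sigma> j) = A (\<sigma> j')" if "j < n" "j' < n" for j j'
  proof -
    have "col ?M j = col ?M j' \<longleftrightarrow> (\<forall>i<m. T $$ (i, \<sigma> j) = T $$ (i, \<sigma> j'))"
      using that by (auto simp: vec_eq_iff)
    also have "\<dots> \<longleftrightarrow> A (\<sigma> j) = A (\<sigma> j')"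
    proof -
      have "T $$ (i, \<sigma> j) = T $$ (i, \<sigma> j') \<longleftrightarrow> (T $$ (i, \<sigma> j) = 1 \<longleftrightarrow> T $$ (i, \<sigma> j') = 1)"
        if "i < m" for i
        using tableau_entry[OF T that \<sigma>[OF \<open>j < n\<close>]] tableau_entry[OF T that \<sigma>[OF \<open>j' < n\<close>]] by auto
      then show ?thesis
        by (auto simp: A_def set_eq_iff)
    qed
    finally show ?thesis .
  qed
  have labels: "permute_list \<sigma> [m..<m + n] ! j = m + \<sigma> j" if "j < n" for j
    using that \<sigma> by (simp add: permute_list_def)
  have zeros: "(\<forall>i<m. \<forall>j<n. ?M $$ (i, j) = 0 \<longrightarrow> (\<forall>j'<j. ?M $$ (i, j') = 0)) \<longleftrightarrow>
      (\<forall>j' j. j' < j \<and> j < n \<longrightarrow> A (\<sigma> j') \<subseteq> A (\<sigma> j))"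
    (is "?L \<longleftrightarrow> ?R")
  proof
    assume L: ?L
    show ?R
    proof (intro allI impI subsetI, elim conjE)
      fix j' j i assume *: "j' < j" "j < n" "i \<in> A (\<sigma> j')"
      then have "i < m" "?M $$ (i, j') \<noteq> 0"
        by (simp_all add: A_def)
      then have "?M $$ (i, j) \<noteq> 0"
        using L[rule_format, OF _ *(2) _ *(1)] by metis
      with * \<open>i < m\<close> entry[of i j] show "i \<in> A (\<sigma> j)"
        by (simp add: A_def)
    qed
  next
    assume R: ?R
    show ?L
    proof (intro allI impI)
      fix i j j' assume *: "i < m" "j < n" "?M $$ (i, j) = 0" "j' < j"
      then have "i \<notin> A (\<sigma> j)" "A (\<sigma> j') \<subseteq> A (\<sigma> j)"
        using R by (simp_all add: A_def)
      then have "i \<notin> A (\<sigma> j')"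
        by blast
      with * entry[of i j'] show "?M $$ (i, j') = 0"
        by (auto simp: A_def)
    qed
  qed
  have "(\<forall>j j'. j < j' \<and> j' < n \<and> col ?M j = col ?M j' \<longrightarrow>
        permute_list \<sigma> [m..<m + n] ! j < permute_list \<sigma> [m..<m + n] ! j') \<longleftrightarrow>
      (\<forall>j j'. j < j' \<and> j' < n \<and> A (\<sigma> j) = A (\<sigma> j') \<longrightarrow> \<sigma> j < \<sigma> j')"
    by (intro iff_allI imp_cong conj_cong refl) (simp_all add: cols labels del: col_mat)
  \<comment> \<open>After rewriting with \<open>zeros\<close> both sides share their first conjunct;
    only the label conditions differ.\<close>
  then have "columns_arranged (?M, [0..<m], permute_list \<sigma> [m..<m + n]) \<longleftrightarrow>
      (\<forall>j' j. j' < j \<and> j < n \<longrightarrow> A (\<sigma> j') \<subseteq> A (\<sigma> j)) \<and>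
      (\<forall>j j'. j < j' \<and> j' < n \<and> A (\<sigma> j) = A (\<sigma> j') \<longrightarrow> \<sigma> j < \<sigma> j')"
    unfolding columns_arranged.simps dim_row_mat dim_col_mat zeros by (rule arg_cong)
  moreover have "permute_columns \<sigma> (initial_labels T) = (?M, [0..<m], permute_list \<sigma> [m..<m + n])"
    by (simp add: initial_labels_def dim)
  ultimately show ?thesis
    by (simp only:) blast
qed

text \<open>Dual to the columns: ones spreading upwards are zeros spreading downwards, hence the
  sets of zeros. The column labels \<open>cs\<close> are arbitrary because the columns have been
  permuted before.\<close>

lemma rows_arranged_permute_iff:
  assumes T: "tableau m n T" and perm: "\<tau> permutes {0..<m}"
  defines "A \<equiv> \<lambda>i. {j. j < n \<and> T $$ (i, j) = 0}"
  shows "rows_arranged (permute_rows \<tau> (T, [0..<m], cs)) \<longleftrightarrow>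
    (\<forall>i j. i < j \<and> j < m \<longrightarrow> A (\<tau> i) \<subseteq> A (\<tau> j) \<and> (A (\<tau> i) = A (\<tau> j) \<longrightarrow> \<tau> i < \<tau> j))"
proof -
  have dim: "dim_row T = m" "dim_col T = n"
    using T by (auto simp: tableau_def)
  have \<tau>: "\<tau> j < m" if "j < m" for j
    using that permutes_in_image[OF perm, of j] by simp
  let ?M = "mat m n (\<lambda>(i, j). T $$ (\<tau> i, j))"
  have entry: "T $$ (\<tau> i, j) \<noteq> 0 \<longleftrightarrow> T $$ (\<tau> i, j) = 1" if "i < m" "j < n" for i j
    using tableau_entry[OF T \<tau>[OF that(1)] that(2)] by auto
  have rows: "row ?M i = row ?M i' \<longleftrightarrow> A (\<tau> i) = A (\<tau> i')" if "i < m" "i' < m" for i i'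
  proof -
    have "row ?M i = row ?M i' \<longleftrightarrow> (\<forall>j<n. T $$ (\<tau> i, j) = T $$ (\<tau> i', j))"
      using that by (auto simp: vec_eq_iff)
    also have "\<dots> \<longleftrightarrow> A (\<tau> i) = A (\<tau> i')"
    proof -
      have "T $$ (\<tau> i, j) = T $$ (\<tau> i', j) \<longleftrightarrow> (T $$ (\<tau> i, j) = 0 \<longleftrightarrow> T $$ (\<tau> i', j) = 0)"
        if "j < n" for j
        using tableau_entry[OF T \<tau>[OF \<open>i < m\<close>] that] tableau_entry[OF T \<tau>[OF \<open>i' < m\<close>] that] by auto
      then show ?thesis
        by (auto simp: A_def set_eq_iff)
    qed
    finally show ?thesis .
  qed
  have labels: "permute_list \<tau> [0..<m] ! i = \<tau> i" if "i < m" for i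
    using that \<tau> by (simp add: permute_list_def)
  have ones: "(\<forall>i<m. \<forall>j<n. ?M $$ (i, j) = 1 \<longrightarrow> (\<forall>i'<i. ?M $$ (i', j) = 1)) \<longleftrightarrow>
      (\<forall>i' i. i' < i \<and> i < m \<longrightarrow> A (\<tau> i') \<subseteq> A (\<tau> i))"
    (is "?L \<longleftrightarrow> ?R")
  proof
    assume L: ?L
    show ?R
    proof (intro allI impI subsetI, elim conjE)
      fix i' i j assume *: "i' < i" "i < m" "j \<in> A (\<tau> i')"
      then have "j < n" "?M $$ (i', j) \<noteq> 1"
        by (simp_all add: A_def)
      then have "?M $$ (i, j) \<noteq> 1"
        using L[rule_format, OF *(2) _ _ *(1)] by metis
      with * \<open>j < n\<close> entry[of i j] show "j \<in> A (\<tau> i)"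
        by (simp add: A_def)
    qed
  next
    assume R: ?R
    show ?L
    proof (intro allI impI)
      fix i j i' assume *: "i < m" "j < n" "?M $$ (i, j) = 1" "i' < i"
      then have "j \<notin> A (\<tau> i)" "A (\<tau> i') \<subseteq> A (\<tau> i)"
        using R by (simp_all add: A_def)
      then have "j \<notin> A (\<tau> i')"
        by blast
      with * entry[of i' j] show "?M $$ (i', j) = 1"
        by (auto simp: A_def)
    qed
  qed
  have "(\<forall>i i'. i < i' \<and> i' < m \<and> row ?M i = row ?M i' \<longrightarrow>
        permute_list \<tau> [0..<m] ! i < permute_list \<tau> [0..<m] ! i') \<longleftrightarrow>
      (\<forall>i i'. i < i' \<and> i' < m \<and> A (\<tau> i) = A (\<tau> i') \<longrightarrow> \<tau> i < \<tau> i')"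
    by (intro iff_allI imp_cong conj_cong refl) (simp_all add: rows labels del: row_mat)
  then have "rows_arranged (?M, permute_list \<tau> [0..<m], cs) \<longleftrightarrow>
      (\<forall>i' i. i' < i \<and> i < m \<longrightarrow> A (\<tau> i') \<subseteq> A (\<tau> i)) \<and>
      (\<forall>i i'. i < i' \<and> i' < m \<and> A (\<tau> i) = A (\<tau> i') \<longrightarrow> \<tau> i < \<tau> i')"
    unfolding rows_arranged.simps dim_row_mat dim_col_mat ones by (rule arg_cong)
  moreover have "permute_rows \<tau> (T, [0..<m], cs) = (?M, permute_list \<tau> [0..<m], cs)"
    by (simp add: dim)
  ultimately show ?thesis
    by (simp only:) blast
qed

text \<open>Two columns with incomparable sets of ones would contain the pattern forbidden in
  \<open>EW\<close>, so these sets form a chain and exactly one permutation arranges them.\<close>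

lemma arrange_columns_initial_labels:
  assumes T: "T \<in> EW m n"
  obtains \<sigma> where "\<sigma> permutes {0..<n}"
    "arrange_columns (initial_labels T) = permute_columns \<sigma> (initial_labels T)"
    "columns_arranged (permute_columns \<sigma> (initial_labels T))"
proof -
  define A where "A = (\<lambda>j. {i. i < m \<and> T $$ (i, j) = 1})"
  have tab: "tableau m n T" and dim: "dim_col (fst (initial_labels T)) = n"
    using T by (auto simp: EW_def tableau_def initial_labels_def)
  have chain: "A j \<subseteq> A j' \<or> A j' \<subseteq> A j" if jj: "j < n" "j' < n" for j j'
  proof (rule ccontr)
    assume "\<not> ?thesis"
    then obtain a b where ab: "a < m" "b < m" "T $$ (a, j) = 1" "T $$ (a, j') \<noteq> 1"
        "T $$ (b, j') = 1" "T $$ (b, j) \<noteq> 1"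
      by (auto simp: A_def)
    then have "T $$ (a, j') = 0" "T $$ (b, j) = 0" "a \<noteq> b" "j \<noteq> j'"
      using tableau_entry[OF tab] jj by metis+
    with ab jj T show False
      unfolding EW_def by blast
  qed
  have "\<exists>!\<sigma>. \<sigma> permutes {0..<n} \<and> columns_arranged (permute_columns \<sigma> (initial_labels T))"
    using ex1_chain_arrangement[of n A, OF _ chain]
    by (simp add: columns_arranged_permute_iff[OF tab] A_def cong: conj_cong)
  then obtain \<sigma> where \<sigma>: "\<sigma> permutes {0..<n}" "columns_arranged (permute_columns \<sigma> (initial_labels T))"
    and uniq: "\<And>\<rho>. \<rho> permutes {0..<n} \<Longrightarrow> columns_arranged (permute_columns \<rho> (initial_labels T)) \<Longrightarrow> \<rho> = \<sigma>"
    by blast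
  \<comment> \<open>The definite description ranges over labelled tableaux; uniqueness of the
    permutation passes to its result.\<close>
  have "arrange_columns (initial_labels T) = permute_columns \<sigma> (initial_labels T)"
    unfolding arrange_columns_def dim
    by (rule the_equality) (use \<sigma> uniq in blast)+
  with \<sigma> show ?thesis
    using that by blast
qed

text \<open>By \<open>arr\<close> the zeros of each row form an initial segment of the columns, and
  initial segments are comparable.\<close>

lemma arrange_rows_chain:
  assumes tab: "tableau m n T"
    and arr: "\<And>i j j'. i < m \<Longrightarrow> j < n \<Longrightarrow> T $$ (i, j) = 0 \<Longrightarrow> j' < j \<Longrightarrow> T $$ (i, j') = 0"
  obtains \<tau> where "\<tau> permutes {0..<m}"
    "arrange_rows (T, [0..<m], cs) = permute_rows \<tau> (T, [0..<m], cs)"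
    "rows_arranged (permute_rows \<tau> (T, [0..<m], cs))"
proof -
  define A where "A = (\<lambda>i. {j. j < n \<and> T $$ (i, j) = 0})"
  have dim: "dim_row T = m"
    using tab by (auto simp: tableau_def)
  have chain: "A i \<subseteq> A i' \<or> A i' \<subseteq> A i" if "i < m" "i' < m" for i i'
  proof (rule ccontr)
    assume "\<not> ?thesis"
    then obtain a b where ab: "a < n" "b < n" "T $$ (i, a) = 0" "T $$ (i', a) \<noteq> 0"
        "T $$ (i', b) = 0" "T $$ (i, b) \<noteq> 0"
      by (auto simp: A_def)
    \<comment> \<open>If \<open>a < b\<close>, the zero of row \<open>i'\<close> at \<open>b\<close>
      forces one at \<open>a\<close>; if \<open>b < a\<close>, the zero of row \<open>i\<close> at
      \<open>a\<close> forces one at \<open>b\<close>.\<close>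
    then show False
      using arr that by (metis linorder_less_linear)
  qed
  have "\<exists>!\<tau>. \<tau> permutes {0..<m} \<and> rows_arranged (permute_rows \<tau> (T, [0..<m], cs))"
    using ex1_chain_arrangement[of m A, OF _ chain]
    by (simp add: rows_arranged_permute_iff[OF tab] A_def
        del: rows_arranged.simps permute_rows.simps cong: conj_cong)
  then obtain \<tau> where \<tau>: "\<tau> permutes {0..<m}" "rows_arranged (permute_rows \<tau> (T, [0..<m], cs))"
    and uniq: "\<And>\<rho>. \<rho> permutes {0..<m} \<Longrightarrow> rows_arranged (permute_rows \<rho> (T, [0..<m], cs)) \<Longrightarrow> \<rho> = \<tau>"
    by blast
  have "arrange_rows (T, [0..<m], cs) = permute_rows \<tau> (T, [0..<m], cs)"
    unfolding arrange_rows_def fst_conv dim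
    by (rule the_equality) (use \<tau> uniq in blast)+
  with \<tau> show ?thesis
    using that by blast
qed

section \<open>Staircase tableaux, their ribbons, and recovery of the staircase\<close>

section \<open>Staircases and ribbons\<close>

text \<open>\<open>z i\<close> counts the zeros of row \<open>i\<close>. The value
  \<open>z m = n\<close> stands for an all-zero row below the tableau, so that the last row obeys
  the same formulas as the others.\<close>

locale staircase_profile =
  fixes m n :: nat and z :: "nat \<Rightarrow> nat"
  assumes m_pos: "1 \<le> m" and n_pos: "1 \<le> n"
    and z_0: "z 0 = 0" and z_m: "z m = n"
    and z_Suc: "\<And>i. i < m \<Longrightarrow> z i \<le> z (Suc i)"
    and z_pos: "\<And>i. 1 \<le> i \<Longrightarrow> i < m \<Longrightarrow> 1 \<le> z i"
begin

definition stair :: "nat mat" where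
  "stair = mat m n (\<lambda>(i, j). if j < z i then 0 else 1)"

lemma z_Suc_pos: "i < m \<Longrightarrow> 1 \<le> z (Suc i)"
  using z_pos[of "Suc i"] z_m n_pos by (cases "Suc i = m") auto

lemma z_mono: "i \<le> k \<Longrightarrow> k \<le> m \<Longrightarrow> z i \<le> z k"
proof (induction k rule: dec_induct)
  case (step k)
  then show ?case using z_Suc[of k] by simp
qed simp

lemma z_le: "i \<le> m \<Longrightarrow> z i \<le> n"
  using z_mono[of i m] z_m by simp

lemma dim_ribbon [simp]: "dim_row (ribbon_of stair) = m" "dim_col (ribbon_of stair) = n"
  by (simp_all add: ribbon_of_def stair_def)

text \<open>The ones of row \<open>i\<close> with no one below them fill the columns from
  \<open>z i\<close> to \<open>z (Suc i) - 1\<close>, and the last zero of the row sits at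
  \<open>z i - 1\<close>; together they form one interval. Row 0 has no zero, and there the
  truncated \<open>z 0 - 1 = 0\<close> is still the correct start.\<close>

lemma ribbon_entry:
  assumes "i < m" "j < n"
  shows "ribbon_of stair $$ (i, j) = (if z i - 1 \<le> j \<and> j < z (Suc i) then 1 else 0)"
proof -
  have entry: "stair $$ (a, b) = (if b < z a then 0 else 1)" if "a < m" "b < n" for a b
    using that by (simp add: stair_def)
  have "stair $$ (i, j) = 1 \<and> (i = m - 1 \<or> stair $$ (i + 1, j) = 0) \<longleftrightarrow> z i \<le> j \<and> j < z (Suc i)"
  proof (cases "i = m - 1")
    \<comment> \<open>At the last row \<open>z m = n\<close> turns \<open>j < z (Suc i)\<close> into
      the trivial \<open>j < n\<close>.\<close>
    case True
    with m_pos z_m have "z (Suc i) = n"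
      by simp
    with True assms show ?thesis
      by (simp add: entry not_less)
  next
    case False
    with assms have "Suc i < m"
      by simp
    with False assms show ?thesis
      by (simp add: entry not_less)
  qed
  moreover have "stair $$ (i, j) = 0 \<and> (j = n - 1 \<or> stair $$ (i, j + 1) = 1) \<longleftrightarrow> j < z i \<and> z i \<le> Suc j"
  proof (cases "j = n - 1")
    \<comment> \<open>Here the bound \<open>z i \<le> Suc j\<close> reads
      \<open>z i \<le> n\<close>, which always holds.\<close>
    case True
    with assms z_le[of i] show ?thesis
      by (simp add: entry)
  next
    case False
    with assms have "Suc j < n"
      by simp
    with False assms show ?thesis
      by (simp add: entry not_less)
  qed
  moreover have "(z i \<le> j \<and> j < z (Suc i)) \<or> (j < z i \<and> z i \<le> Suc j) \<longleftrightarrow> z i - 1 \<le> j \<and> j < z (Suc i)"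
    using z_Suc[OF assms(1)] z_Suc_pos[OF assms(1)] by linarith
  moreover have "dim_row stair = m" "dim_col stair = n"
    by (simp_all add: stair_def)
  ultimately show ?thesis
    using assms by (simp add: ribbon_of_def)
qed

lemma ribbon_one_iff:
  assumes "i < m"
  shows "j < n \<and> ribbon_of stair $$ (i, j) = 1 \<longleftrightarrow> j \<in> {z i - 1..<z (Suc i)}"
  using assms z_le[of "Suc i"] by (cases "j < n") (simp_all add: ribbon_entry)

lemma row_interval: "i < m \<Longrightarrow> z i - 1 < z (Suc i)"
  using z_Suc[of i] z_Suc_pos[of i] by linarith

lemma leftmost_ribbon: "i < m \<Longrightarrow> leftmost (ribbon_of stair) i = z i - 1"
  unfolding leftmost_def using row_interval[of i]
  by (intro Min_eqI) (simp_all add: ribbon_one_iff del: One_nat_def)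

lemma rightmost_ribbon: "i < m \<Longrightarrow> rightmost (ribbon_of stair) i = z (Suc i) - 1"
  unfolding rightmost_def using row_interval[of i]
  by (intro Max_eqI) (auto simp: ribbon_one_iff simp del: One_nat_def)

text \<open>The ribbon enters column \<open>j\<close> in the last row whose \<open>z\<close> is at
  most \<open>j\<close>, that is, at the lowest one of this column in the staircase. Hence columns
  with equal \<open>topmost\<close> are equal columns of the staircase.\<close>

lemma topmost_ribbon:
  assumes "j < n" "i < m"
  shows "z i \<le> j \<longleftrightarrow> i \<le> topmost (ribbon_of stair) j"
proof -
  \<comment> \<open>The row where the profile crosses \<open>j\<close>, so that
    \<open>z k \<le> j < z (Suc k)\<close>; it exists because \<open>z m = n\<close>.\<close>
  define k where "k = (LEAST i. j < z (Suc i))"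
  have "j < z (Suc (m - 1))"
    using assms z_m m_pos by simp
  then have k: "j < z (Suc k)" and "k \<le> m - 1"
    unfolding k_def by (rule LeastI, rule Least_le)
  then have "k < m"
    using m_pos by linarith
  have least: "z (Suc i) \<le> j" if "i < k" for i
    using not_less_Least[of i "\<lambda>i. j < z (Suc i)"] that by (simp add: k_def)
  have zk: "z k \<le> j"
    using least z_0 by (cases k) simp_all
  have top: "topmost (ribbon_of stair) j = k"
    unfolding topmost_def
  proof (intro Min_eqI)
    show "k \<in> {i. i < dim_row (ribbon_of stair) \<and> ribbon_of stair $$ (i, j) = 1}"
      using \<open>k < m\<close> assms k zk by (simp add: ribbon_entry)
    fix i assume "i \<in> {i. i < dim_row (ribbon_of stair) \<and> ribbon_of stair $$ (i, j) = 1}"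
    then have "j < z (Suc i)"
      using assms ribbon_one_iff[of i j] by simp
    then show "k \<le> i"
      unfolding k_def by (rule Least_le)
  qed simp
  show ?thesis
  proof
    assume "z i \<le> j"
    then show "i \<le> topmost (ribbon_of stair) j"
      using z_mono[of "Suc k" i] k assms top by (cases "i \<le> k") simp_all
  next
    assume "i \<le> topmost (ribbon_of stair) j"
    then show "z i \<le> j"
      using z_mono[of i k] zk top \<open>k < m\<close> by simp
  qed
qed

text \<open>Row \<open>i\<close> contributes \<open>z (Suc i) - z i + 1\<close> for
  \<open>i > 0\<close>, but only \<open>z 1\<close> for \<open>i = 0\<close>, where the subtraction
  truncates; the sum telescopes to \<open>n + (m - 1)\<close>.\<close>

lemma ribbon_card: "card {(i, j). i < m \<and> j < n \<and> ribbon_of stair $$ (i, j) = 1} = m + n - 1"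
proof -
  have "{(i, j). i < m \<and> j < n \<and> ribbon_of stair $$ (i, j) = 1}
      = (SIGMA i:{..<m}. {z i - 1..<z (Suc i)})"
    using ribbon_one_iff by blast
  then have "card {(i, j). i < m \<and> j < n \<and> ribbon_of stair $$ (i, j) = 1}
      = (\<Sum>i<m. z (Suc i) - (z i - 1))"
    by simp
  \<comment> \<open>Generalised to partial sums for the induction; row 0, which lacks the extra one,
    is the base case.\<close>
  also have "(\<Sum>i<Suc k. z (Suc i) - (z i - 1)) = z (Suc k) + k" if "Suc k \<le> m" for k
    using that
  proof (induction k)
    case (Suc k)
    then show ?case
      using z_Suc_pos[of k] z_Suc[of "Suc k"] by simp
  qed (simp add: z_0)
  from this[of "m - 1"] have "(\<Sum>i<m. z (Suc i) - (z i - 1)) = m + n - 1"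
    using m_pos z_m by simp
  finally show ?thesis .
qed

lemma ribbon_stair: "ribbon m n (ribbon_of stair)"
  unfolding ribbon_def parallelogram_polyomino_def
proof (intro conjI ribbon_card allI impI)
  show "tableau m n (ribbon_of stair)"
    by (auto simp: tableau_def ribbon_entry intro!: carrier_matI)
  show "ribbon_of stair $$ (0, 0) = 1"
    using m_pos n_pos z_Suc_pos[of 0] z_0 by (simp add: ribbon_entry)
  show "ribbon_of stair $$ (m - 1, n - 1) = 1"
    using m_pos n_pos z_m z_le[of "m - 1"] by (simp add: ribbon_entry diff_le_mono)
  show "\<exists>j<n. ribbon_of stair $$ (i, j) = 1" if "i < m" for i
    using ribbon_one_iff[OF that, of "z i - 1"] row_interval[OF that] by (intro exI[of _ "z i - 1"]) simp
  show "ribbon_of stair $$ (i, k) = 1"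
    if "i < m" "j \<le> k \<and> k \<le> l \<and> l < n \<and> ribbon_of stair $$ (i, j) = 1 \<and> ribbon_of stair $$ (i, l) = 1"
    for i j k l
    using that ribbon_one_iff[of i j] ribbon_one_iff[of i k] ribbon_one_iff[of i l] by simp
  \<comment> \<open>Row \<open>i - 1\<close> ends in column \<open>z i - 1\<close>, exactly where
    row \<open>i\<close> begins, so the middle inequality is an equality.\<close>
  fix i assume i: "1 \<le> i \<and> i < m"
  then show "leftmost (ribbon_of stair) (i - 1) \<le> leftmost (ribbon_of stair) i"
    "leftmost (ribbon_of stair) i \<le> rightmost (ribbon_of stair) (i - 1)"
    "rightmost (ribbon_of stair) (i - 1) \<le> rightmost (ribbon_of stair) i"
    using z_Suc[of "i - 1"] z_Suc[of i]
    by (auto simp: leftmost_ribbon rightmost_ribbon diff_le_mono)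
qed

end

text \<open>The right end of row \<open>k\<close> is \<open>z (Suc k) - 1\<close>, and
  \<open>z (Suc k) \<ge> 1\<close> makes the subtraction reversible; \<open>z 0\<close> is
  fixed.\<close>

lemma ribbon_of_stair_inj:
  assumes "staircase_profile m n z" "staircase_profile m n z'"
    and eq: "ribbon_of (staircase_profile.stair m n z) = ribbon_of (staircase_profile.stair m n z')"
  shows "staircase_profile.stair m n z = staircase_profile.stair m n z'"
proof -
  interpret a: staircase_profile m n z by fact
  interpret b: staircase_profile m n z' by fact
  have "z i = z' i" if "i < m" for i
  proof (cases i)
    case 0
    then show ?thesis
      by (simp add: a.z_0 b.z_0)
  next
    case (Suc k)
    with that have k: "k < m"
      by simp
    have "z (Suc k) - 1 = z' (Suc k) - 1"
      using a.rightmost_ribbon[OF k] b.rightmost_ribbon[OF k] eq by simp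
    with Suc a.z_Suc_pos[OF k] b.z_Suc_pos[OF k] show ?thesis
      by simp
  qed
  then show ?thesis
    unfolding a.stair_def b.stair_def by (intro cong_mat) simp_all
qed

section \<open>Normal form of \<open>phi\<close>, its values and its injectivity\<close>

section \<open>The map\<close>

text \<open>Expresses \<open>phi T\<close> by explicit data: two permutations and the profile
  \<open>z\<close> of the arranged tableau. The last two clauses are the tie-breaking rules in terms
  of \<open>z\<close>: rows with equal \<open>z\<close> are identical, and columns are identical
  when the same thresholds \<open>z i\<close> are at most their indices.\<close>

lemma phi_EW:
  assumes T: "T \<in> EW m n" and mn: "1 \<le> m" "1 \<le> n"
  obtains \<sigma> \<tau> z where "\<sigma> permutes {0..<n}" "\<tau> permutes {0..<m}" "\<tau> 0 = 0"
    "staircase_profile m n z"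
    "mat m n (\<lambda>(i, j). T $$ (\<tau> i, \<sigma> j)) = staircase_profile.stair m n z"
    "phi T = (ribbon_of (staircase_profile.stair m n z), map \<tau> [0..<m], map (\<lambda>j. m + \<sigma> j) [0..<n])"
    "\<forall>i i'. i < i' \<and> i' < m \<and> z i = z i' \<longrightarrow> \<tau> i < \<tau> i'"
    "\<forall>j j'. j < j' \<and> j' < n \<and> (\<forall>i<m. z i \<le> j \<longleftrightarrow> z i \<le> j') \<longrightarrow> \<sigma> j < \<sigma> j'"
proof -
  have tab: "tableau m n T" and dim: "dim_row T = m" "dim_col T = n"
    using T by (auto simp: EW_def tableau_def)
  have top: "T $$ (0, j) = 1" if "j < n" for j
    using T that by (simp add: EW_def)
  have zero: "\<exists>j<n. T $$ (i, j) = 0" if "i < m" "i \<noteq> 0" for i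
    using T that by (simp add: EW_def)
  obtain \<sigma> where \<sigma>: "\<sigma> permutes {0..<n}"
    and arr: "arrange_columns (initial_labels T) = permute_columns \<sigma> (initial_labels T)"
    and arrC: "columns_arranged (permute_columns \<sigma> (initial_labels T))"
    using arrange_columns_initial_labels[OF T] .
  have \<sigma>_lt: "\<sigma> j < n" if "j < n" for j
    using that permutes_in_image[OF \<sigma>, of j] by simp
  define U where "U = mat m n (\<lambda>(i, j). T $$ (i, \<sigma> j))"
  define cs where "cs = permute_list \<sigma> [m..<m + n]"
  have cs: "cs = map (\<lambda>j. m + \<sigma> j) [0..<n]"
    using \<sigma>_lt by (simp add: cs_def permute_list_def)
  have LU: "permute_columns \<sigma> (initial_labels T) = (U, [0..<m], cs)"
    by (simp add: initial_labels_def U_def cs_def dim)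
  have tabU: "tableau m n U"
    using tab \<sigma>_lt by (auto simp: tableau_def U_def)
  have left: "U $$ (i, j') = 0" if "i < m" "j < n" "U $$ (i, j) = 0" "j' < j" for i j j'
    using arrC that unfolding LU by (auto simp: U_def)
  have colsU: "\<sigma> j < \<sigma> j'" if "j < j'" "j' < n" "\<And>i. i < m \<Longrightarrow> U $$ (i, j) = U $$ (i, j')" for j j'
  proof -
    have "col U j = col U j'"
      using that by (auto simp: vec_eq_iff U_def)
    then have "cs ! j < cs ! j'"
      using arrC that unfolding LU by (auto simp: U_def)
    with that show ?thesis
      by (simp add: cs)
  qed
  obtain \<tau> where \<tau>: "\<tau> permutes {0..<m}"
    and arrR: "arrange_rows (U, [0..<m], cs) = permute_rows \<tau> (U, [0..<m], cs)"
      "rows_arranged (permute_rows \<tau> (U, [0..<m], cs))"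
    using arrange_rows_chain[OF tabU left] .
  have \<tau>_lt: "\<tau> i < m" if "i < m" for i
    using that permutes_in_image[OF \<tau>, of i] by simp
  have \<tau>_surj: "\<exists>k<m. \<tau> k = i" if "i < m" for i
    using that permutes_image[OF \<tau>] by (metis atLeastLessThan_iff imageE zero_le)
  have \<sigma>_surj: "\<exists>k<n. \<sigma> k = j" if "j < n" for j
    using that permutes_image[OF \<sigma>] by (metis atLeastLessThan_iff imageE zero_le)
  define V where "V = mat m n (\<lambda>(i, j). T $$ (\<tau> i, \<sigma> j))"
  have dimV: "dim_row V = m" "dim_col V = n"
    by (simp_all add: V_def)
  have VU: "V $$ (i, j) = U $$ (\<tau> i, j)" if "i < m" "j < n" for i j
    using that \<tau>_lt by (simp add: V_def U_def)
  have "permute_list \<tau> [0..<m] = map \<tau> [0..<m]"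
    using \<tau>_lt by (simp add: permute_list_def)
  moreover have "mat m n (\<lambda>(i, j). U $$ (\<tau> i, j)) = V"
    by (intro eq_matI) (simp_all add: VU dimV)
  ultimately have LV: "permute_rows \<tau> (U, [0..<m], cs) = (V, map \<tau> [0..<m], cs)"
    using tabU by (auto simp: tableau_def)
  have V01: "V $$ (i, j) = 0 \<or> V $$ (i, j) = 1" if "i < m" "j < n" for i j
    using that tableau_entry[OF tab] \<tau>_lt \<sigma>_lt by (simp add: V_def)
  \<comment> \<open>Permuting whole rows keeps the zeros of each row an initial segment.\<close>
  have leftV: "V $$ (i, j') = 0" if "i < m" "j < n" "V $$ (i, j) = 0" "j' < j" for i j j'
    using left[of "\<tau> i" j j'] that \<tau>_lt by (simp add: VU)
  have aboveV: "V $$ (i', j) = 1" if "i < m" "j < n" "V $$ (i, j) = 1" "i' < i" for i i' j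
    using arrR(2) that unfolding LV by (auto simp: dimV)
  have rowsV: "\<tau> i < \<tau> i'" if "i < i'" "i' < m" "\<And>j. j < n \<Longrightarrow> V $$ (i, j) = V $$ (i', j)" for i i'
  proof -
    have "row V i = row V i'"
      using that by (auto simp: vec_eq_iff dimV)
    then have "map \<tau> [0..<m] ! i < map \<tau> [0..<m] ! i'"
      using arrR(2) that unfolding LV by (auto simp: dimV)
    with that show ?thesis
      by simp
  qed
  have \<tau>0: "\<tau> 0 = 0"
  proof -
    \<comment> \<open>The all-one row of \<open>T\<close> lands at position \<open>k\<close>; ones
      spread upwards from there, so row 0 of \<open>V\<close> is all ones too and can only come from
      row 0 of \<open>T\<close>.\<close>
    obtain k where k: "k < m" "\<tau> k = 0"
      using \<tau>_surj[of 0] mn by auto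
    have "V $$ (0, j) = 1" if "j < n" for j
      using aboveV[of k j 0] that k top \<sigma>_lt by (cases "k = 0") (simp_all add: V_def)
    then have "T $$ (\<tau> 0, j) \<noteq> 0" if "j < n" for j
      using that \<sigma>_surj[OF that] mn by (auto simp: V_def)
    then show ?thesis
      using zero \<tau>_lt[of 0] mn by fastforce
  qed
  \<comment> \<open>Position of the first one in row \<open>i\<close>; the alternative
    \<open>k = n\<close> gives an all-zero row the value \<open>n\<close>.\<close>
  define z where "z i = (if i < m then LEAST k. k = n \<or> V $$ (i, k) = 1 else n)" for i
  have zle: "z i \<le> n" for i
    by (auto simp: z_def intro: Least_le)
  have Vz: "V $$ (i, j) = (if j < z i then 0 else 1)" if ij: "i < m" "j < n" for i j
  proof (cases "j < z i")
    case True
    then show ?thesis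
      using not_less_Least[of j "\<lambda>k. k = n \<or> V $$ (i, k) = 1"] V01 ij by (auto simp: z_def)
  next
    case False
    \<comment> \<open>Row \<open>i\<close> has a one at \<open>z i\<close>, and a zero further right
      would force a zero there.\<close>
    have "z i = n \<or> V $$ (i, z i) = 1"
      using LeastI[of "\<lambda>k. k = n \<or> V $$ (i, k) = 1" n] ij by (simp add: z_def)
    with False ij have "V $$ (i, z i) = 1" "z i \<le> j"
      by auto
    with leftV[OF ij, of "z i"] V01[OF ij] False show ?thesis
      by (cases "z i = j") auto
  qed
  have prof: "staircase_profile m n z"
  proof
    show "1 \<le> m" "1 \<le> n" by fact+
    have "V $$ (0, 0) = 1"
      using mn top \<sigma>_lt by (simp add: V_def \<tau>0)
    then show "z 0 = 0"
      using Vz[of 0 0] mn by (cases "z 0") auto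
    show "z m = n"
      by (simp add: z_def)
    show "z i \<le> z (Suc i)" if "i < m" for i
    proof (cases "Suc i < m")
      case True
      \<comment> \<open>A descent of \<open>z\<close> would put a one of row \<open>Suc i\<close>,
        in column \<open>z (Suc i)\<close>, below a zero of row \<open>i\<close>.\<close>
      show ?thesis
      proof (rule ccontr)
        assume less: "\<not> z i \<le> z (Suc i)"
        then have "z (Suc i) < n"
          using zle[of i] by simp
        with aboveV[of "Suc i" "z (Suc i)" i] less that True show False
          by (simp add: Vz)
      qed
    next
      case False
      then show ?thesis
        using zle by (simp add: z_def)
    qed
    show "1 \<le> z i" if "1 \<le> i" "i < m" for i
    proof -
      have "\<tau> i \<noteq> 0"
        using \<tau>0 that permutes_inj[OF \<tau>] by (metis injD not_one_le_zero)
      then obtain j where "j < n" "T $$ (\<tau> i, j) = 0"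
        using zero[OF \<tau>_lt[OF \<open>i < m\<close>]] by blast
      then obtain k where "k < n" "V $$ (i, k) = 0"
        using \<sigma>_surj[of j] \<open>i < m\<close> by (auto simp: V_def)
      then show ?thesis
        using Vz[of i k] that by (auto split: if_splits)
    qed
  qed
  have stair: "V = staircase_profile.stair m n z"
    unfolding staircase_profile.stair_def[OF prof]
    by (intro eq_matI) (simp_all add: Vz dimV)
  have "phi T = (ribbon_of V, map \<tau> [0..<m], cs)"
    by (simp add: phi_def arr LU arrR(1) LV del: permute_rows.simps permute_columns.simps)
  moreover have "\<forall>i i'. i < i' \<and> i' < m \<and> z i = z i' \<longrightarrow> \<tau> i < \<tau> i'"
    using rowsV by (simp add: Vz)
  moreover have "\<forall>j j'. j < j' \<and> j' < n \<and> (\<forall>i<m. z i \<le> j \<longleftrightarrow> z i \<le> j') \<longrightarrow> \<sigma> j < \<sigma> j'"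
  proof (intro allI impI, elim conjE)
    fix j j' assume j: "j < j'" "j' < n" and same: "\<forall>i<m. z i \<le> j \<longleftrightarrow> z i \<le> j'"
    show "\<sigma> j < \<sigma> j'"
    proof (rule colsU[OF j])
      fix i assume "i < m"
      \<comment> \<open>Equality of columns is tested in \<open>U\<close>, whose rows are those of
        \<open>V\<close> in another order.\<close>
      then obtain k where "k < m" "i = \<tau> k"
        using \<tau>_surj by blast
      with j same show "U $$ (i, j) = U $$ (i, j')"
        by (simp add: VU[symmetric] Vz not_le[symmetric])
    qed
  qed
  ultimately show ?thesis
    using that[OF \<sigma> \<tau> \<tau>0 prof] stair by (simp add: V_def cs)
qed

text \<open>The tie-breaking rules of the two arrangements become the label conditions of the
  ribbon, since \<open>leftmost\<close> and \<open>topmost\<close> detect equal rows and columns of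
  the staircase, up to one exception at row 0.\<close>

lemma phi_in_LRib:
  assumes T: "T \<in> EW m n" and mn: "1 \<le> m" "1 \<le> n"
  shows "phi T \<in> LRib m n"
proof -
  obtain \<sigma> \<tau> z where \<sigma>: "\<sigma> permutes {0..<n}" and \<tau>: "\<tau> permutes {0..<m}" "\<tau> 0 = 0"
    and prof: "staircase_profile m n z"
    and "mat m n (\<lambda>(i, j). T $$ (\<tau> i, \<sigma> j)) = staircase_profile.stair m n z"
    and phi: "phi T = (ribbon_of (staircase_profile.stair m n z), map \<tau> [0..<m], map (\<lambda>j. m + \<sigma> j) [0..<n])"
    and rows: "\<forall>i i'. i < i' \<and> i' < m \<and> z i = z i' \<longrightarrow> \<tau> i < \<tau> i'"
    and cols: "\<forall>j j'. j < j' \<and> j' < n \<and> (\<forall>i<m. z i \<le> j \<longleftrightarrow> z i \<le> j') \<longrightarrow> \<sigma> j < \<sigma> j'"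
    using phi_EW[OF T mn] .
  interpret staircase_profile m n z by fact
  have "map \<tau> [0..<m] \<in> permutations_of_set {0..<m}"
    using permutes_image[OF \<tau>(1)] permutes_inj_on[OF \<tau>(1)]
    by (auto simp: permutations_of_set_def distinct_map)
  moreover have "map (\<lambda>j. m + \<sigma> j) [0..<n] \<in> permutations_of_set {m..<m + n}"
  proof -
    have "(\<lambda>j. m + \<sigma> j) ` {0..<n} = (+) m ` (\<sigma> ` {0..<n})"
      by (simp add: image_image)
    also have "\<dots> = {m..<m + n}"
      by (simp add: permutes_image[OF \<sigma>] add.commute)
    finally show ?thesis
      using permutes_inj_on[OF \<sigma>] by (auto simp: permutations_of_set_def distinct_map inj_on_def)
  qed
  moreover have "\<tau> i < \<tau> i'"
    if "i < i'" "i' < m" "leftmost (ribbon_of stair) i = leftmost (ribbon_of stair) i'" for i i'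
  proof (cases "i = 0")
    \<comment> \<open>By truncation row 0 shares its left end with the rows where
      \<open>z i' = 1\<close>, although these differ from it in the staircase; here the label 0 of
      the top row is the smallest.\<close>
    case True
    then have "\<tau> i' \<noteq> \<tau> 0"
      using that permutes_inj[OF \<tau>(1)] by (metis injD less_irrefl)
    with True \<tau>(2) show ?thesis
      by simp
  next
    case False
    then have "z i = z i'"
      using that z_pos[of i] z_pos[of i'] by (simp add: leftmost_ribbon)
    with rows that show ?thesis
      by blast
  qed
  \<comment> \<open>By \<open>topmost_ribbon\<close>, equal topmost rows mean that \<open>j\<close>
    and \<open>j'\<close> lie weakly above the same values of \<open>z\<close>.\<close>
  moreover have "\<sigma> j < \<sigma> j'"
    if "j < j'" "j' < n" "topmost (ribbon_of stair) j = topmost (ribbon_of stair) j'" for j j'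
    using cols that topmost_ribbon by simp
  ultimately show ?thesis
    using ribbon_stair mn \<tau>(2) by (auto simp: LRib_def LPP_def phi ribbon_def)
qed

text \<open>The ribbon determines the staircase and the labels determine both permutations on their
  index ranges, so equal values of \<open>phi\<close> come from undoing the same permutations on the
  same staircase.\<close>

lemma phi_inj_on_EW:
  assumes mn: "1 \<le> m" "1 \<le> n"
  shows "inj_on phi (EW m n)"
proof (rule inj_onI)
  fix S T assume S: "S \<in> EW m n" and T: "T \<in> EW m n" and eq: "phi S = phi T"
  obtain \<sigma> \<tau> z where \<sigma>: "\<sigma> permutes {0..<n}" and \<tau>: "\<tau> permutes {0..<m}"
    and prof: "staircase_profile m n z"
    and mat: "mat m n (\<lambda>(i, j). S $$ (\<tau> i, \<sigma> j)) = staircase_profile.stair m n z"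
    and phi: "phi S = (ribbon_of (staircase_profile.stair m n z), map \<tau> [0..<m], map (\<lambda>j. m + \<sigma> j) [0..<n])"
    by (rule phi_EW[OF S mn]) (rule that; assumption)
  obtain \<sigma>' \<tau>' z' where prof': "staircase_profile m n z'"
    and mat': "mat m n (\<lambda>(i, j). T $$ (\<tau>' i, \<sigma>' j)) = staircase_profile.stair m n z'"
    and phi': "phi T = (ribbon_of (staircase_profile.stair m n z'), map \<tau>' [0..<m], map (\<lambda>j. m + \<sigma>' j) [0..<n])"
    by (rule phi_EW[OF T mn]) (rule that; assumption)
  have \<tau>\<tau>': "\<tau>' i = \<tau> i" if "i < m" for i
    using eq that by (simp add: phi phi')
  have \<sigma>\<sigma>': "\<sigma>' j = \<sigma> j" if "j < n" for j
    using eq that by (simp add: phi phi')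
  have "staircase_profile.stair m n z = staircase_profile.stair m n z'"
    using eq by (intro ribbon_of_stair_inj prof prof') (simp add: phi phi')
  then have mats: "mat m n (\<lambda>(i, j). S $$ (\<tau> i, \<sigma> j)) = mat m n (\<lambda>(i, j). T $$ (\<tau>' i, \<sigma>' j))"
    by (simp add: mat mat')
  have entry: "S $$ (\<tau> i, \<sigma> j) = T $$ (\<tau> i, \<sigma> j)" if "i < m" "j < n" for i j
    using arg_cong[OF mats, of "\<lambda>M. M $$ (i, j)"] that by (simp add: \<tau>\<tau>' \<sigma>\<sigma>')
  have dims: "dim_row S = m" "dim_col S = n" "dim_row T = m" "dim_col T = n"
    using S T by (auto simp: EW_def tableau_def)
  show "S = T"
  proof (rule eq_matI)
    \<comment> \<open>Every position \<open>(a, b)\<close> has the form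
      \<open>(\<tau> i, \<sigma> j)\<close>, where \<open>entry\<close> applies.\<close>
    fix a b assume ab: "a < dim_row T" "b < dim_col T"
    then have "a \<in> \<tau> ` {0..<m}" "b \<in> \<sigma> ` {0..<n}"
      by (simp_all add: permutes_image[OF \<tau>] permutes_image[OF \<sigma>] dims)
    then show "S $$ (a, b) = T $$ (a, b)"
      using entry by auto
  qed (simp_all add: dims)
qed

theorem theorem3p5:
  fixes m n :: nat
  assumes "m \<ge> 1" and "n \<ge> 1"
  shows "phi \<in> EW m n \<rightarrow> LRib m n \<and> inj_on phi (EW m n)"
  using assms phi_in_LRib phi_inj_on_EW by blast

end
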